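(* Let $p$ be a prime number, $n\ge 1$ an integer, $q=p^n$, and let $R=\mathbb{F}_q[t;\theta]$ be the Ore extension where $\theta$ is the Frobenius map $\theta(a)=a^p$. Extend $\theta$ to $R$ by setting $\theta(t)=t$. Let $G(t)=t^{(p-1)n+1}-t$ and $G_0(t)=t^{(p-1)n}-1$. Then: (a) The polynomial $G(t)$ (resp. $G_0(t)$) is the least left common multiple of all the linear polynomials $t-a$ with $a\in\mathbb{F}_q$ (resp. with $0\ne a\in\mathbb{F}_q$). (b) For any $h(t)\in R$ we have $G(t)h(t)=\theta(h(t))G(t)$. The polynomial $G_0(t)$ belongs to the center of $R$. (c) If $g(t),h(t)\in R$ are monic polynomials such that $h(t)g(t)=G(t)$, then $\theta(g(t))h(t)=G(t)$. Similarly, if $h(t)g(t)=G_0(t)$ then $g(t)h(t)=G_0(t)$. (d) The $W$-polynomials of $R$ are exactly the monic right factors of $G(t)$, and they are also exactly the monic left factors of $G(t)$.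
   Context: $R=\mathbb{F}_q[t;\theta]$ consists of polynomials $\sum a_it^i$ with coefficients $a_i\in\mathbb{F}_q$ written on the left, with usual addition and multiplication determined by $ta=\theta(a)t$ for $a\in\mathbb{F}_q$. The extension of $\theta$ to $R$ is $\theta(\sum a_it^i)=\sum\theta(a_i)t^i$. A least left common multiple of a family of linear polynomials $t-a$ ($a\in S$) is the monic polynomial $m$ with $Rm=\bigcap_{a\in S}R(t-a)$. A monic polynomial $g(t)\in R$ of degree $r$ is a Wedderburn polynomial ($W$-polynomial) if there exist $a_1,\dots,a_r\in\mathbb{F}_q$ with $Rg(t)=\bigcap_{i=1}^{r}R(t-a_i)$ (for $r=0$ the empty intersection is $R$). A right factor of $G$ is a $g$ with $G\in Rg$; a left factor of $G$ is a $g$ with $G\in gR$. *)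

theory Defs
  imports
    "HOL-Computational_Algebra.Computational_Algebra"
    "HOL-Algebra.Coset"
    "HOL-Algebra.Ring"
begin

text \<open>
  The Ore extension \<open>K[t;\<theta>]\<close> is given the additive group of \<^typ>\<open>'a poly\<close>, the coefficients being
  read as left coefficients.  Only the product differs from the one of \<^typ>\<open>'a poly\<close>: from
  \<open>t b = \<theta>(b) t\<close> one gets \<open>(a t\<^sup>i) (b t\<^sup>j) = a \<theta>\<^sup>i(b) t\<^bsup>i+j\<^esup>\<close>.  The operator \<open>*\<close> of the type class on
  polynomials is not used for the elements of the Ore extension.
\<close>

definition skew_mult :: "('a::field \<Rightarrow> 'a) \<Rightarrow> 'a poly \<Rightarrow> 'a poly \<Rightarrow> 'a poly" where
  "skew_mult \<theta> f g =
     (\<Sum>i\<le>degree f. \<Sum>j\<le>degree g. monom (coeff f i * (\<theta> ^^ i) (coeff g j)) (i + j))"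

definition skew_poly_ring :: "('a::field \<Rightarrow> 'a) \<Rightarrow> 'a poly ring" where
  "skew_poly_ring \<theta> =
     \<lparr>carrier = UNIV, mult = skew_mult \<theta>, one = 1, zero = 0, add = (+)\<rparr>"

definition left_multiples :: "('b, 'm) ring_scheme \<Rightarrow> 'b \<Rightarrow> 'b set" where
  "left_multiples R g = carrier R #>\<^bsub>R\<^esub> g"

definition right_multiples :: "('b, 'm) ring_scheme \<Rightarrow> 'b \<Rightarrow> 'b set" where
  "right_multiples R g = g <#\<^bsub>R\<^esub> carrier R"

definition right_factor :: "('b, 'm) ring_scheme \<Rightarrow> 'b \<Rightarrow> 'b \<Rightarrow> bool" where
  "right_factor R g f \<longleftrightarrow> f \<in> left_multiples R g"

definition left_factor :: "('b, 'm) ring_scheme \<Rightarrow> 'b \<Rightarrow> 'b \<Rightarrow> bool" where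
  "left_factor R g f \<longleftrightarrow> f \<in> right_multiples R g"

definition ring_center :: "('b, 'm) ring_scheme \<Rightarrow> 'b set" where
  "ring_center R = {z \<in> carrier R. \<forall>x \<in> carrier R. z \<otimes>\<^bsub>R\<^esub> x = x \<otimes>\<^bsub>R\<^esub> z}"

abbreviation monic :: "'a::field poly \<Rightarrow> bool" where
  "monic f \<equiv> lead_coeff f = 1"

text \<open>Below, \<open>[:- a, 1:]\<close> is the linear polynomial \<open>t - a\<close>.\<close>

definition is_llcm_linear :: "('a::field poly, 'm) ring_scheme \<Rightarrow> 'a set \<Rightarrow> 'a poly \<Rightarrow> bool" where
  "is_llcm_linear R S m \<longleftrightarrow>
     monic m \<and> left_multiples R m = (\<Inter>a\<in>S. left_multiples R [:- a, 1:])"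

text \<open>
  For \<open>degree g = 0\<close> the intersection below is the empty one, that is \<^term>\<open>UNIV\<close>, which is the
  carrier of \<^term>\<open>skew_poly_ring \<theta>\<close>.
\<close>

definition W_polynomial :: "('a::field poly, 'm) ring_scheme \<Rightarrow> 'a poly \<Rightarrow> bool" where
  "W_polynomial R g \<longleftrightarrow> monic g \<and>
     (\<exists>a :: nat \<Rightarrow> 'a.
        left_multiples R g = (\<Inter>i\<in>{1..degree g}. left_multiples R [:- a i, 1:]))"

text \<open>
  For a field endomorphism \<open>\<theta>\<close>, the structure \<^term>\<open>skew_poly_ring \<theta>\<close> is indeed a ring satisfying
  \<open>t a = \<theta>(a) t\<close>, and a least left common multiple is unique.
\<close>

locale field_endo =
  fixes \<theta> :: "'a::field \<Rightarrow> 'a"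
  assumes endo_add: "\<theta> (x + y) = \<theta> x + \<theta> y"
    and endo_mult: "\<theta> (x * y) = \<theta> x * \<theta> y"
    and endo_one: "\<theta> 1 = 1"
begin

lemma endo_zero: "\<theta> 0 = 0"
  by (metis add_cancel_left_left endo_add)

lemma funpow_add: "(\<theta> ^^ i) (x + y) = (\<theta> ^^ i) x + (\<theta> ^^ i) y"
  by (induction i) (simp_all add: endo_add)

lemma funpow_mult: "(\<theta> ^^ i) (x * y) = (\<theta> ^^ i) x * (\<theta> ^^ i) y"
  by (induction i) (simp_all add: endo_mult)

lemma funpow_one: "(\<theta> ^^ i) 1 = 1"
  by (induction i) (simp_all add: endo_one)

lemma funpow_zero: "(\<theta> ^^ i) 0 = 0"
  by (induction i) (simp_all add: endo_zero)

lemma coeff_skew_mult: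
  "coeff (skew_mult \<theta> f g) n = (\<Sum>i\<le>n. coeff f i * (\<theta> ^^ i) (coeff g (n - i)))"
proof -
  define c where "c i j = coeff f i * (\<theta> ^^ i) (coeff g j)" for i j
  define N where "N = n + degree f + degree g"
  have "coeff (skew_mult \<theta> f g) n =
          (\<Sum>i\<le>degree f. \<Sum>j\<le>degree g. if i + j = n then c i j else 0)"
    by (simp add: skew_mult_def coeff_sum c_def cong: if_cong)
  also have "\<dots> = (\<Sum>i\<le>N. \<Sum>j\<le>degree g. if i + j = n then c i j else 0)"
    by (rule sum.mono_neutral_left)
       (auto simp: N_def c_def coeff_eq_0 intro!: sum.neutral)
  also have "\<dots> = (\<Sum>i\<le>N. \<Sum>j\<le>N. if i + j = n then c i j else 0)"
    by (intro sum.cong refl sum.mono_neutral_left)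
       (auto simp: N_def c_def coeff_eq_0 funpow_zero)
  also have "\<dots> = (\<Sum>i\<le>N. if i \<le> n then c i (n - i) else 0)"
  proof (intro sum.cong refl)
    fix i
    have "(\<Sum>j\<le>N. if i + j = n then c i j else 0) =
            (\<Sum>j\<le>N. if j = n - i then (if i \<le> n then c i (n - i) else 0) else 0)"
      by (intro sum.cong) auto
    then show "(\<Sum>j\<le>N. if i + j = n then c i j else 0) = (if i \<le> n then c i (n - i) else 0)"
      by (auto simp: N_def)
  qed
  also have "\<dots> = (\<Sum>i\<le>n. c i (n - i))"
    by (rule sum.mono_neutral_cong_right) (auto simp: N_def)
  finally show ?thesis by (simp add: c_def)
qed

lemma skew_mult_add_left: "skew_mult \<theta> (f + g) h = skew_mult \<theta> f h + skew_mult \<theta> g h"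
  by (rule poly_eqI) (simp add: coeff_skew_mult distrib_right sum.distrib)

lemma skew_mult_add_right: "skew_mult \<theta> h (f + g) = skew_mult \<theta> h f + skew_mult \<theta> h g"
  by (rule poly_eqI) (simp add: coeff_skew_mult funpow_add distrib_left sum.distrib)

lemma skew_mult_monom:
  "skew_mult \<theta> (monom a i) (monom b j) = monom (a * (\<theta> ^^ i) b) (i + j)"
proof (rule poly_eqI)
  fix n
  have "coeff (skew_mult \<theta> (monom a i) (monom b j)) n =
          (\<Sum>k\<le>n. if k = i then (if n - i = j then a * (\<theta> ^^ i) b else 0) else 0)"
    unfolding coeff_skew_mult by (intro sum.cong) (auto simp: funpow_zero)
  then show "coeff (skew_mult \<theta> (monom a i) (monom b j)) n =
               coeff (monom (a * (\<theta> ^^ i) b) (i + j)) n"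
    by auto
qed

lemma t_commute:
  "skew_mult \<theta> (monom 1 1) [:a:] = skew_mult \<theta> [:\<theta> a:] (monom 1 1)"
  using skew_mult_monom[of 1 1 a 0] skew_mult_monom[of "\<theta> a" 0 1 1]
  by (simp add: monom_0)

lemma poly_add_induct:
  assumes "\<And>a n. P (monom a n)" "\<And>f g. P f \<Longrightarrow> P g \<Longrightarrow> P (f + g)"
  shows "P (f :: 'a poly)"
proof -
  have "P (\<Sum>i\<le>n. monom (coeff f i) i)" for n
    by (induction n) (use assms in auto)
  from this[of "degree f"] show ?thesis
    by (simp add: poly_as_sum_of_monoms)
qed

lemma skew_mult_assoc:
  "skew_mult \<theta> (skew_mult \<theta> f g) h = skew_mult \<theta> f (skew_mult \<theta> g h)"
proof (induction f rule: poly_add_induct)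
  case f: (1 a i)
  show ?case
  proof (induction g rule: poly_add_induct)
    case g: (1 b j)
    show ?case
    proof (induction h rule: poly_add_induct)
      case (1 c k)
      then show ?case
        by (simp add: skew_mult_monom funpow_mult funpow_add add.assoc mult.assoc)
          (simp add: Nat.funpow_add)
    qed (simp add: skew_mult_add_right)
  qed (simp add: skew_mult_add_right skew_mult_add_left)
qed (simp add: skew_mult_add_left)

lemma skew_mult_one_left: "skew_mult \<theta> 1 f = f"
proof (induction f rule: poly_add_induct)
  case (1 a n)
  then show ?case using skew_mult_monom[of 1 0 a n] by simp
qed (simp add: skew_mult_add_right)

lemma skew_mult_one_right: "skew_mult \<theta> f 1 = f"
proof (induction f rule: poly_add_induct)
  case (1 a n)
  then show ?case using skew_mult_monom[of a n 1 0] by (simp add: funpow_one)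
qed (simp add: skew_mult_add_left)

lemma ring_skew_poly_ring: "ring (skew_poly_ring \<theta>)"
proof (rule ringI)
  show "abelian_group (skew_poly_ring \<theta>)"
    by (rule abelian_groupI)
       (auto simp: skew_poly_ring_def add_ac intro: exI[of _ "- x" for x])
  show "Group.monoid (skew_poly_ring \<theta>)"
    by (rule monoidI)
       (auto simp: skew_poly_ring_def skew_mult_assoc skew_mult_one_left skew_mult_one_right)
qed (auto simp: skew_poly_ring_def skew_mult_add_left skew_mult_add_right)

lemma lead_coeff_skew_mult_monic:
  assumes "monic g"
  shows "coeff (skew_mult \<theta> h g) (degree h + degree g) = lead_coeff h"
proof -
  have "coeff (skew_mult \<theta> h g) (degree h + degree g) =
          (\<Sum>i\<le>degree h + degree g. if i = degree h then lead_coeff h else 0)"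
    unfolding coeff_skew_mult
  proof (intro sum.cong refl)
    fix i
    consider "i < degree h" | "i = degree h" | "i > degree h" by linarith
    then show "coeff h i * (\<theta> ^^ i) (coeff g (degree h + degree g - i)) =
                 (if i = degree h then lead_coeff h else 0)"
      using assms by cases (auto simp: coeff_eq_0 funpow_zero funpow_one)
  qed
  then show ?thesis by simp
qed

lemma left_multiples_monic_eqD:
  assumes m: "monic m" and m': "monic m'"
    and eq: "left_multiples (skew_poly_ring \<theta>) m = left_multiples (skew_poly_ring \<theta>) m'"
  shows "m = m'"
proof -
  have mem: "\<exists>h. f = skew_mult \<theta> h g"
    if "f \<in> left_multiples (skew_poly_ring \<theta>) g" for f g :: "'a poly"
    using that by (auto simp: left_multiples_def r_coset_def skew_poly_ring_def)
  have self: "f \<in> left_multiples (skew_poly_ring \<theta>) f" for f :: "'a poly"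
    using skew_mult_one_left[of f]
    by (auto simp: left_multiples_def r_coset_def skew_poly_ring_def intro!: exI[of _ 1])
  have le: "degree h + degree g \<le> degree f"
    if "f = skew_mult \<theta> h g" "monic g" "monic f" for f g h :: "'a poly"
  proof (rule le_degree)
    have "h \<noteq> 0"
      using that by (auto simp: skew_mult_def)
    then show "coeff f (degree h + degree g) \<noteq> 0"
      using lead_coeff_skew_mult_monic[of g h] that by simp
  qed
  obtain h where h: "m = skew_mult \<theta> h m'" using mem self eq by metis
  obtain k where k: "m' = skew_mult \<theta> k m" using mem self eq by metis
  have "degree h = 0" "degree m = degree m'"
    using le[OF h m' m] le[OF k m m'] by auto
  moreover from this have "lead_coeff h = 1"
    using lead_coeff_skew_mult_monic[OF m', of h] h m by simp
  ultimately have "h = 1"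
    by (metis degree_eq_zeroE coeff_pCons_0 one_pCons)
  then show ?thesis using h skew_mult_one_left by simp
qed

lemma is_llcm_linear_unique:
  assumes "is_llcm_linear (skew_poly_ring \<theta>) S m" "is_llcm_linear (skew_poly_ring \<theta>) S m'"
  shows "m = m'"
  using assms left_multiples_monic_eqD unfolding is_llcm_linear_def by auto

end

end

theory Submission
  imports Defs
begin

text \<open>
  Let \<open>t\<close> act on the field as \<open>T\<^sub>a c = \<theta>(c) a\<close>.  Then \<open>f\<close> lies in \<open>R (t - a)\<close> iff \<open>f(T\<^sub>a) 1 = 0\<close>, and for
  \<open>c \<noteq> 0\<close> one has \<open>f(T\<^sub>a) c = 0\<close> iff the conjugate \<open>\<theta>(c) a / c\<close> is a root of \<open>f\<close>.  Let \<open>weight f\<close> be the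
  product of the numbers \<open>card (ker f(T\<^sub>a))\<close> over \<open>a \<noteq> 0\<close>, times \<open>p\<^sup>M\<close> with \<open>M = (q - 1) / (p - 1)\<close> if
  \<open>f(0) = 0\<close>.  It is submultiplicative, equals \<open>p\<^sup>M\<close> for linear \<open>f\<close>, and equals \<open>1\<close> if \<open>f\<close> has no root.
  Splitting off right roots, \<open>weight f \<le> p ^ (M * degree f)\<close>.  A polynomial that vanishes on the whole
  field has the weight \<open>p ^ (M * degree G)\<close>, and \<open>G\<close> is such a polynomial; so \<open>G\<close> has the least degree, which
  is (a).  Parts (b) and (c) are computations based on \<open>\<theta>\<^sup>n = id\<close> and cancellation.  For (d), \<open>G = h g\<close>
  attains the bound, hence so does \<open>g\<close>; as the weight depends only on the set of roots, \<open>g\<close> is the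
  least left common multiple belonging to its roots.  Left and right factors are exchanged by (c).
\<close>

context field_endo
begin

abbreviation skew_times :: "'a poly \<Rightarrow> 'a poly \<Rightarrow> 'a poly" (infixl "\<star>" 70) where
  "f \<star> g \<equiv> skew_mult \<theta> f g"

abbreviation T :: "'a \<Rightarrow> 'a \<Rightarrow> 'a" where
  "T a \<equiv> \<lambda>c. \<theta> c * a"

text \<open>The module \<open>R / R (t - a)\<close> is the field with \<open>t\<close> acting as \<open>T a\<close>, and \<open>skew_op a\<close> is the
  action of \<open>R\<close> on it.  In particular \<open>skew_op a f 1\<close> is the right evaluation of \<open>f\<close> at \<open>a\<close>, the
  remainder of \<open>f\<close> on right division by \<open>t - a\<close>.\<close>

definition skew_op :: "'a \<Rightarrow> 'a poly \<Rightarrow> 'a \<Rightarrow> 'a" where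
  "skew_op a f c = (\<Sum>i\<le>degree f. coeff f i * (T a ^^ i) c)"

section \<open>Degrees, cancellation and right division in the Ore extension\<close>

lemma endo_eq_0_iff [simp]: "\<theta> x = 0 \<longleftrightarrow> x = 0"
proof (cases "x = 0")
  case False
  then have "\<theta> x * \<theta> (inverse x) = 1"
    by (simp add: endo_one flip: endo_mult)
  with False show ?thesis by auto
qed (simp add: endo_zero)

lemma funpow_endo_eq_0_iff [simp]: "(\<theta> ^^ i) x = 0 \<longleftrightarrow> x = 0"
  by (induction i) auto

lemma endo_minus: "\<theta> (- x) = - \<theta> x"
  by (metis add.right_inverse endo_add endo_zero minus_unique)

lemma endo_diff: "\<theta> (x - y) = \<theta> x - \<theta> y"
  using endo_add[of x "- y"] by (simp add: endo_minus)

lemma skew_mult_zero_left [simp]: "0 \<star> f = 0"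
  by (simp add: skew_mult_def)

lemma skew_mult_zero_right [simp]: "f \<star> 0 = 0"
  by (rule poly_eqI) (simp add: coeff_skew_mult funpow_zero)

lemma skew_mult_minus_left: "(- f) \<star> h = - (f \<star> h)"
  by (rule poly_eqI) (simp add: coeff_skew_mult sum_negf)

lemma skew_mult_diff_left: "(f - g) \<star> h = f \<star> h - g \<star> h"
  using skew_mult_add_left[of f "- g" h] by (simp add: skew_mult_minus_left)

lemma skew_mult_diff_right: "h \<star> (f - g) = h \<star> f - h \<star> g"
  using skew_mult_add_right[of h "f - g" g] by (simp add: algebra_simps)

lemma coeff_0_skew_mult [simp]: "coeff (f \<star> g) 0 = coeff f 0 * coeff g 0"
  by (simp add: coeff_skew_mult)

lemma coeff_skew_mult_degree:
  "coeff (h \<star> g) (degree h + degree g) = lead_coeff h * (\<theta> ^^ degree h) (lead_coeff g)"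
proof -
  have "coeff (h \<star> g) (degree h + degree g) =
          (\<Sum>i\<le>degree h + degree g.
             if i = degree h then lead_coeff h * (\<theta> ^^ degree h) (lead_coeff g) else 0)"
    unfolding coeff_skew_mult
  proof (intro sum.cong refl)
    fix i
    consider "i < degree h" | "i = degree h" | "i > degree h" by linarith
    then show "coeff h i * (\<theta> ^^ i) (coeff g (degree h + degree g - i)) =
                 (if i = degree h then lead_coeff h * (\<theta> ^^ degree h) (lead_coeff g) else 0)"
      by cases (auto simp: coeff_eq_0 funpow_zero)
  qed
  then show ?thesis by simp
qed

lemma degree_skew_mult:
  assumes "h \<noteq> 0" "g \<noteq> 0"
  shows "degree (h \<star> g) = degree h + degree g"
proof (rule antisym)
  show "degree (h \<star> g) \<le> degree h + degree g"
  proof (rule degree_le, intro allI impI)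
    fix i assume i: "degree h + degree g < i"
    show "coeff (h \<star> g) i = 0"
      unfolding coeff_skew_mult
    proof (intro sum.neutral ballI)
      fix j
      consider "degree h < j" | "degree g < i - j" using i by linarith
      then show "coeff h j * (\<theta> ^^ j) (coeff g (i - j)) = 0"
        by cases (auto simp: coeff_eq_0 funpow_zero)
    qed
  qed
  show "degree h + degree g \<le> degree (h \<star> g)"
    by (rule le_degree) (use assms in \<open>simp add: coeff_skew_mult_degree\<close>)
qed

lemma lead_coeff_skew_mult:
  "lead_coeff (h \<star> g) = lead_coeff h * (\<theta> ^^ degree h) (lead_coeff g)"
proof (cases "h = 0 \<or> g = 0")
  case False
  then show ?thesis
    using coeff_skew_mult_degree[of h g] by (simp add: degree_skew_mult)
qed (auto simp: funpow_zero)

lemma skew_mult_eq_0_iff [simp]: "h \<star> g = 0 \<longleftrightarrow> h = 0 \<or> g = 0"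
  using lead_coeff_skew_mult[of h g] by auto

lemma skew_mult_right_cancel: "g \<noteq> 0 \<Longrightarrow> f \<star> g = h \<star> g \<longleftrightarrow> f = h"
  by (metis right_minus_eq skew_mult_diff_left skew_mult_eq_0_iff)

lemma map_poly_skew_mult: "map_poly \<theta> (f \<star> g) = map_poly \<theta> f \<star> map_poly \<theta> g"
proof (rule poly_eqI)
  fix i
  have *: "\<theta> (\<Sum>j\<in>A. F j) = (\<Sum>j\<in>A. \<theta> (F j))" for A :: "nat set" and F
    by (induction A rule: infinite_finite_induct) (simp_all add: endo_zero endo_add)
  show "coeff (map_poly \<theta> (f \<star> g)) i = coeff (map_poly \<theta> f \<star> map_poly \<theta> g) i"
    by (simp add: coeff_map_poly endo_zero coeff_skew_mult * endo_mult funpow_swap1)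
qed

lemma skew_division_monic:
  assumes "monic m"
  shows "\<exists>k r. f = k \<star> m + r \<and> (r = 0 \<or> degree r < degree m)"
proof (induction "degree f" arbitrary: f rule: less_induct)
  case less
  show ?case
  proof (cases "f = 0 \<or> degree f < degree m")
    case True
    then show ?thesis by (intro exI[of _ 0] exI[of _ f]) auto
  next
    case False
    define k where "k = monom (lead_coeff f) (degree f - degree m)"
    have m: "m \<noteq> 0" using assms by auto
    have k: "k \<noteq> 0" "degree k = degree f - degree m"
      using False by (auto simp: k_def degree_monom_eq)
    have d: "degree (k \<star> m) = degree f"
      using False m k by (simp add: degree_skew_mult)
    have c: "lead_coeff (k \<star> m) = lead_coeff f"
      using assms k(2) by (simp add: lead_coeff_skew_mult funpow_one) (simp add: k_def)
    define f' where "f' = f - k \<star> m"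
    show ?thesis
    proof (cases "f' = 0")
      case True
      then have "f = k \<star> m + 0" by (simp add: f'_def)
      then show ?thesis by blast
    next
      case nz: False
      have "degree f' \<le> degree f"
        unfolding f'_def using d by (intro degree_diff_le) auto
      moreover have "coeff f' (degree f) = 0"
        using c d by (simp add: f'_def)
      ultimately have "degree f' < degree f"
        using nz by (metis leading_coeff_0_iff le_neq_implies_less)
      from less[OF this] obtain k' r where "f' = k' \<star> m + r" "r = 0 \<or> degree r < degree m"
        by blast
      then have "f = (k + k') \<star> m + r"
        by (simp add: f'_def skew_mult_add_left algebra_simps)
      with \<open>r = 0 \<or> degree r < degree m\<close> show ?thesis by blast
    qed
  qed
qed

section \<open>The action of the Ore extension on the field\<close>

lemma skew_op_eq_sum:
  "degree f \<le> N \<Longrightarrow> skew_op a f c = (\<Sum>i\<le>N. coeff f i * (T a ^^ i) c)"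
  unfolding skew_op_def by (rule sum.mono_neutral_left) (auto simp: coeff_eq_0)

lemma skew_op_poly_add: "skew_op a (f + g) c = skew_op a f c + skew_op a g c"
proof -
  define N where "N = max (degree f) (degree g)"
  have "degree (f + g) \<le> N" "degree f \<le> N" "degree g \<le> N"
    by (auto simp: N_def degree_add_le_max)
  then show ?thesis
    by (simp add: skew_op_eq_sum[of _ N] distrib_right sum.distrib)
qed

lemma skew_op_poly_0 [simp]: "skew_op a 0 c = 0"
  by (simp add: skew_op_def)

lemma skew_op_poly_diff: "skew_op a (f - g) c = skew_op a f c - skew_op a g c"
  using skew_op_poly_add[of a "f - g" g c] by simp

lemma skew_op_monom: "skew_op a (monom b i) c = b * (T a ^^ i) c"
proof -
  have "skew_op a (monom b i) c = (\<Sum>j\<le>i. coeff (monom b i) j * (T a ^^ j) c)"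
    by (rule skew_op_eq_sum) (rule degree_monom_le)
  also have "\<dots> = (\<Sum>j\<le>i. if j = i then b * (T a ^^ i) c else 0)"
    by (intro sum.cong) auto
  finally show ?thesis by simp
qed

lemma skew_op_linear: "skew_op a [:- b, 1:] c = \<theta> c * a - b * c"
  by (simp add: skew_op_def)

lemma T_funpow_add: "(T a ^^ i) (c + d) = (T a ^^ i) c + (T a ^^ i) d"
  by (induction i) (simp_all add: endo_add distrib_right)

lemma T_funpow_mult: "(T a ^^ i) (b * c) = (\<theta> ^^ i) b * (T a ^^ i) c"
  by (induction i) (simp_all add: endo_mult)

lemma skew_op_add: "skew_op a f (c + d) = skew_op a f c + skew_op a f d"
  by (simp add: skew_op_def T_funpow_add distrib_left sum.distrib)

lemma skew_op_0 [simp]: "skew_op a f 0 = 0"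
  using skew_op_add[of a f 0 0] by (metis add.right_neutral add_left_cancel)

lemma skew_op_diff: "skew_op a f (c - d) = skew_op a f c - skew_op a f d"
  using skew_op_add[of a f "c - d" d] by simp

text \<open>Both sides are additive in \<open>f\<close> and in \<open>g\<close>, so monomials
  suffice; for these it is the semilinearity \<open>T_funpow_mult\<close>. A value of
  \<open>g\<close> thus enters as an argument of \<open>f\<close>, not as a scalar factor.\<close>

lemma skew_op_mult: "skew_op a (f \<star> g) c = skew_op a f (skew_op a g c)"
proof (induction f rule: poly_add_induct)
  case (1 b i)
  show ?case
  proof (induction g rule: poly_add_induct)
    case (1 d j)
    show ?case
      by (simp only: skew_mult_monom skew_op_monom T_funpow_mult Nat.funpow_add o_apply mult.assoc)
  qed (simp add: skew_mult_add_right skew_op_poly_add skew_op_add)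
qed (simp add: skew_mult_add_left skew_op_poly_add)

lemma skew_op_0_left: "skew_op 0 f c = coeff f 0 * c"
proof (induction f rule: poly_add_induct)
  case (1 b i)
  then show ?case by (cases i) (simp_all add: skew_op_monom)
qed (simp add: skew_op_poly_add distrib_right)

text \<open>Right multiplication by \<open>c\<close> intertwines \<open>T a\<close> with
  \<open>T (\<theta> c * a / c)\<close>, hence also all polynomials in these two operators.\<close>

lemma skew_op_conjugate:
  assumes "c \<noteq> 0"
  shows "skew_op a f (d * c) = skew_op (\<theta> c * a / c) f d * c"
proof -
  have "(T a ^^ i) (d * c) = (T (\<theta> c * a / c) ^^ i) d * c" for i
    using assms by (induction i) (simp_all add: endo_mult)
  then show ?thesis
    by (simp add: skew_op_def sum_distrib_right mult.assoc)
qed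

lemma skew_op_eq_0_iff_root:
  assumes "c \<noteq> 0"
  shows "skew_op a f c = 0 \<longleftrightarrow> skew_op (\<theta> c * a / c) f 1 = 0"
  using skew_op_conjugate[OF assms, of a f 1] assms by simp

section \<open>Left multiples and least left common multiples of linear polynomials\<close>

lemma carrier_skew_poly_ring [simp]: "carrier (skew_poly_ring \<theta>) = UNIV"
  by (simp add: skew_poly_ring_def)

lemma mult_skew_poly_ring [simp]: "mult (skew_poly_ring \<theta>) = skew_mult \<theta>"
  by (simp add: skew_poly_ring_def)

abbreviation multiples :: "'a poly \<Rightarrow> 'a poly set" where
  "multiples \<equiv> left_multiples (skew_poly_ring \<theta>)"

lemma left_multiples_iff: "f \<in> multiples g \<longleftrightarrow> (\<exists>h. f = h \<star> g)"
  by (auto simp: left_multiples_def r_coset_def)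

lemma right_multiples_iff:
  "f \<in> right_multiples (skew_poly_ring \<theta>) g \<longleftrightarrow> (\<exists>h. f = g \<star> h)"
  by (auto simp: right_multiples_def l_coset_def)

lemma left_multiples_self: "f \<in> multiples f"
  unfolding left_multiples_iff by (metis skew_mult_one_left)

text \<open>Right division by \<open>t - a\<close> leaves a constant. Since \<open>t - a\<close>
  annihilates \<open>1\<close> under \<open>T a\<close>, that constant is
  \<open>skew_op a f 1\<close>.\<close>

lemma left_multiples_linear_iff: "f \<in> multiples [:- a, 1:] \<longleftrightarrow> skew_op a f 1 = 0"
proof
  assume "f \<in> multiples [:- a, 1:]"
  then show "skew_op a f 1 = 0"
    by (auto simp: left_multiples_iff skew_op_mult skew_op_linear endo_one)
next
  assume *: "skew_op a f 1 = 0"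
  obtain k r where f: "f = k \<star> [:- a, 1:] + r" and "r = 0 \<or> degree r < degree [:- a, 1:]"
    using skew_division_monic[of "[:- a, 1:]" f] by auto
  then have "degree r = 0" by auto
  then obtain b where r: "r = [:b:]" by (metis degree_eq_zeroE)
  have "skew_op a r 1 = 0"
    using * unfolding f by (simp add: skew_op_poly_add skew_op_mult skew_op_linear endo_one)
  then have "r = 0" by (simp add: r skew_op_def)
  then show "f \<in> multiples [:- a, 1:]"
    using f by (auto simp: left_multiples_iff)
qed

lemma mem_Inter_linear_iff:
  "f \<in> (\<Inter>a\<in>S. multiples [:- a, 1:]) \<longleftrightarrow> (\<forall>a\<in>S. skew_op a f 1 = 0)"
  by (simp add: left_multiples_linear_iff)

lemma is_llcm_linear_iff:
  "is_llcm_linear (skew_poly_ring \<theta>) S m \<longleftrightarrow>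
     monic m \<and> (\<forall>f. f \<in> multiples m \<longleftrightarrow> (\<forall>a\<in>S. skew_op a f 1 = 0))"
  unfolding is_llcm_linear_def set_eq_iff mem_Inter_linear_iff ..

text \<open>The remainder of \<open>f\<close> on right division by \<open>m\<close> again vanishes
  on \<open>S\<close>, so minimality of the degree of \<open>m\<close> forces it to be
  \<open>0\<close>.\<close>

lemma is_llcm_linearI:
  assumes "monic m" "\<forall>a\<in>S. skew_op a m 1 = 0"
    and min: "\<And>f. f \<noteq> 0 \<Longrightarrow> \<forall>a\<in>S. skew_op a f 1 = 0 \<Longrightarrow> degree m \<le> degree f"
  shows "is_llcm_linear (skew_poly_ring \<theta>) S m"
  unfolding is_llcm_linear_iff
proof (intro conjI allI iffI ballI)
  fix f assume f: "\<forall>a\<in>S. skew_op a f 1 = 0"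
  obtain k r where kr: "f = k \<star> m + r" "r = 0 \<or> degree r < degree m"
    using skew_division_monic[OF assms(1)] by blast
  have "skew_op a r 1 = 0" if "a \<in> S" for a
    using f assms(2) that by (simp add: kr(1) skew_op_poly_add skew_op_mult)
  then have "r = 0" using min[of r] kr(2) by fastforce
  then show "f \<in> multiples m" using kr(1) by (auto simp: left_multiples_iff)
qed (use assms in \<open>auto simp: left_multiples_iff skew_op_mult\<close>)

text \<open>The points are adjoined one at a time, and \<open>B\<close> collects those at which the
  degree grows, each time by one. Such a \<open>B\<close> supplies the exactly
  \<open>degree m\<close> points that \<open>W_polynomial\<close> asks for.\<close>

lemma ex_llcm_linear_basis:
  assumes "finite S"
  shows "\<exists>m B. B \<subseteq> S \<and> card B = degree m \<and>
           is_llcm_linear (skew_poly_ring \<theta>) S m \<and> is_llcm_linear (skew_poly_ring \<theta>) B m"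
  using assms
proof (induction S rule: finite_induct)
  case empty
  have "is_llcm_linear (skew_poly_ring \<theta>) {} 1"
    unfolding is_llcm_linear_iff left_multiples_iff by (auto simp: skew_mult_one_right)
  then show ?case by (intro exI[of _ 1] exI[of _ "{}"]) auto
next
  case (insert b S)
  then obtain m B where m: "B \<subseteq> S" "card B = degree m"
      "is_llcm_linear (skew_poly_ring \<theta>) S m" "is_llcm_linear (skew_poly_ring \<theta>) B m"
    by blast
  define c where "c = skew_op b m 1"
  show ?case
  proof (cases "c = 0")
    case True
    then have "skew_op b f 1 = 0" if "f \<in> multiples m" for f
      using that by (auto simp: c_def left_multiples_iff skew_op_mult)
    then have "is_llcm_linear (skew_poly_ring \<theta>) (insert b S) m"
      using m(3) unfolding is_llcm_linear_iff by auto
    then show ?thesis using m by blast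
  next
    case False
    \<comment> \<open>At \<open>b\<close> the polynomial \<open>m\<close> has the value
      \<open>c\<close>, and the new left factor is the monic linear polynomial that annihilates
      \<open>c\<close> under \<open>T b\<close>; its root is the conjugate of \<open>b\<close> by
      \<open>c\<close>.\<close>
    define m' where "m' = [:- (\<theta> c * b / c), 1:] \<star> m"
    have monic: "monic m" using m(3) by (simp add: is_llcm_linear_iff)
    then have "m \<noteq> 0" by auto
    then have deg: "degree m' = Suc (degree m)"
      by (simp add: m'_def degree_skew_mult)
    have monic': "monic m'"
      unfolding m'_def lead_coeff_skew_mult using monic by (simp add: endo_one)
    have step: "is_llcm_linear (skew_poly_ring \<theta>) (insert b X) m'"
      if X: "is_llcm_linear (skew_poly_ring \<theta>) X m" for X
      unfolding is_llcm_linear_iff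
    proof (intro conjI allI iffI)
      fix f assume "f \<in> multiples m'"
      then obtain k where k: "f = k \<star> [:- (\<theta> c * b / c), 1:] \<star> m"
        by (auto simp: left_multiples_iff m'_def skew_mult_assoc)
      then have "f \<in> multiples m" by (auto simp: left_multiples_iff)
      moreover have "skew_op b f 1 = 0"
        using False by (simp add: k skew_op_mult skew_op_linear flip: c_def)
      ultimately show "\<forall>a\<in>insert b X. skew_op a f 1 = 0"
        using X by (simp add: is_llcm_linear_iff)
    next
      fix f assume f: "\<forall>a\<in>insert b X. skew_op a f 1 = 0"
      then have "f \<in> multiples m" using X by (simp add: is_llcm_linear_iff)
      then obtain k where k: "f = k \<star> m" by (auto simp: left_multiples_iff)
      have "skew_op b k c = 0" using f by (simp add: k skew_op_mult c_def)
      then have "k \<in> multiples [:- (\<theta> c * b / c), 1:]"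
        using False skew_op_eq_0_iff_root[of c b k] by (simp add: left_multiples_linear_iff)
      then show "f \<in> multiples m'"
        by (auto simp: k left_multiples_iff m'_def skew_mult_assoc)
    qed (rule monic')
    have "b \<notin> B" using insert m by blast
    moreover have "finite B" using insert m finite_subset by blast
    ultimately have "card (insert b B) = degree m'" using deg m by simp
    with step[OF m(3)] step[OF m(4)] m(1) show ?thesis
      by (intro exI[of _ m'] exI[of _ "insert b B"]) blast
  qed
qed

lemma W_polynomial_if_llcm:
  assumes "finite S" "is_llcm_linear (skew_poly_ring \<theta>) S g"
  shows "W_polynomial (skew_poly_ring \<theta>) g"
proof -
  obtain m B where B: "B \<subseteq> S" "card B = degree m" "is_llcm_linear (skew_poly_ring \<theta>) S m"
      "is_llcm_linear (skew_poly_ring \<theta>) B m"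
    using ex_llcm_linear_basis[OF assms(1)] by blast
  have [simp]: "m = g" using is_llcm_linear_unique B assms(2) by blast
  have "finite B" using B(1) assms(1) finite_subset by blast
  then obtain a where "bij_betw a {1..card B} B" using ex_bij_betw_nat_finite_1 by blast
  then have "(\<lambda>x. multiples [:- x, 1:]) ` B = (\<lambda>i. multiples [:- a i, 1:]) ` {1..degree g}"
    using B(2) by (auto simp: bij_betw_def)
  then show ?thesis
    using B(4) unfolding W_polynomial_def is_llcm_linear_def by auto
qed

end

text \<open>The kernel of the composition is the union of the fibres of \<open>g\<close> over the
  zeros of \<open>f\<close>, and a nonempty fibre is a translate of the kernel of
  \<open>g\<close>.\<close>

lemma card_kernel_comp_le:
  fixes f g :: "'a::{finite,ab_group_add} \<Rightarrow> 'a"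
  assumes diff: "\<And>x y. g (x - y) = g x - g y"
  shows "card {x. f (g x) = 0} \<le> card {x. f x = 0} * card {x. g x = 0}"
proof -
  have fibre: "card {x. g x = y} \<le> card {x. g x = 0}" for y
  proof (cases "\<exists>x. g x = y")
    case True
    then obtain x0 where x0: "g x0 = y" by blast
    show ?thesis
      by (rule card_inj_on_le[of "\<lambda>x. x - x0"]) (auto simp: inj_on_def diff x0)
  qed simp
  have "{x. f (g x) = 0} = (\<Union>y\<in>{y. f y = 0}. {x. g x = y})" by auto
  then have "card {x. f (g x) = 0} \<le> (\<Sum>y\<in>{y. f y = 0}. card {x. g x = y})"
    by (simp add: card_UN_le)
  also have "\<dots> \<le> card {x. f x = 0} * card {x. g x = 0}"
    using sum_bounded_above[of "{y. f y = 0}" "\<lambda>y. card {x. g x = y}"] fibre by simp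
  finally show ?thesis .
qed

section \<open>The finite field and its Frobenius map\<close>

locale finite_frobenius =
  fixes \<theta> :: "'a::finite_field \<Rightarrow> 'a" and p n :: nat
  assumes prime_p: "prime p" and n_pos: "n \<ge> 1"
    and card_field: "card (UNIV :: 'a set) = p ^ n"
    and frobenius: "\<theta> = (\<lambda>a. a ^ p)"
begin

lemma p_ge_2: "p \<ge> 2"
  using prime_p by (rule prime_ge_2_nat)

text \<open>Translation by \<open>1\<close> permutes the field, so comparing the sums of
  \<open>x\<close> and of \<open>x + 1\<close> over all \<open>x\<close> gives
  \<open>p ^ n = 0\<close> in the field.\<close>

lemma CHAR_eq_p: "CHAR('a) = p"
proof -
  have "(\<Sum>x\<in>UNIV. x + 1 :: 'a) = (\<Sum>x\<in>UNIV. x)"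
    by (rule sum.reindex_bij_witness[of _ "\<lambda>x. x - 1" "\<lambda>x. x + 1"]) auto
  then have "of_nat (card (UNIV :: 'a set)) = (0 :: 'a)"
    by (simp add: sum.distrib)
  then have "of_nat p = (0 :: 'a)"
    by (simp add: card_field)
  then have "CHAR('a) dvd p"
    by (simp add: of_nat_eq_0_iff_char_dvd)
  then show ?thesis
    using prime_p CHAR_prime[where 'a = 'a] primes_dvd_imp_eq by blast
qed

end

sublocale finite_frobenius \<subseteq> field_endo \<theta>
  by unfold_locales
     (simp_all add: frobenius freshmans_dream CHAR_eq_p prime_p power_mult_distrib)

context finite_frobenius
begin

lemma endo_funpow_n: "(\<theta> ^^ n) x = x"
proof -
  have "(\<theta> ^^ k) x = x ^ (p ^ k)" for k
    by (induction k) (simp_all add: frobenius flip: power_mult, simp add: mult.commute)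
  then show ?thesis
    using finite_field_power_card_eq_same[of x] by (simp add: card_field)
qed

lemma endo_funpow_mult_n: "(\<theta> ^^ (k * n)) x = x"
  by (induction k) (simp_all add: Nat.funpow_add endo_funpow_n)

text \<open>The fixed elements are the roots of the commutative polynomial \<open>P\<close>, of
  degree at most \<open>p\<close>; conversely the images of \<open>0, ..., p - 1\<close> are fixed,
  and distinct in characteristic \<open>p\<close>.\<close>

lemma card_fixed_field: "card {c. \<theta> c = c} = p"
proof (rule antisym)
  define P :: "'a poly" where "P = monom 1 p - monom 1 1"
  have "coeff P p \<noteq> 0" using p_ge_2 by (simp add: P_def)
  then have "P \<noteq> 0" by auto
  have "{c. \<theta> c = c} = {c. poly P c = 0}"
    by (simp add: P_def frobenius poly_monom)
  moreover have "degree P \<le> p"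
    unfolding P_def using p_ge_2 by (intro degree_diff_le) (auto simp: degree_monom_eq)
  ultimately show "card {c. \<theta> c = c} \<le> p"
    using card_poly_roots_bound[OF \<open>P \<noteq> 0\<close>] by simp
  have "inj_on (of_nat :: nat \<Rightarrow> 'a) {..<p}"
  proof (rule linorder_inj_onI)
    fix i j assume "i < j" "i \<in> {..<p}" "j \<in> {..<p}"
    then have "\<not> p dvd j - i" by (auto dest: dvd_imp_le)
    then have "of_nat (j - i) \<noteq> (0 :: 'a)"
      by (simp only: of_nat_eq_0_iff_char_dvd CHAR_eq_p not_False_eq_True)
    then show "of_nat i \<noteq> (of_nat j :: 'a)"
      using \<open>i < j\<close> by (auto simp: of_nat_diff)
  qed auto
  moreover have "\<theta> (of_nat i) = of_nat i" for i
    by (induction i) (simp_all add: endo_zero endo_add endo_one)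
  ultimately show "p \<le> card {c. \<theta> c = c}"
    using card_inj_on_le[of of_nat "{..<p}" "{c. \<theta> c = c}"] by auto
qed

text \<open>The kernel is the line spanned by \<open>c\<close> over the fixed field, because
  \<open>\<theta>\<close> fixes the quotient \<open>x / c\<close> for every solution
  \<open>x\<close> of \<open>\<theta> x * a = b * x\<close>.\<close>

lemma card_kernel_linear:
  assumes "c \<noteq> 0" "\<theta> c * a = b * c" "b \<noteq> 0"
  shows "card {x. skew_op a [:- b, 1:] x = 0} = p"
proof -
  have a: "a \<noteq> 0" using assms by auto
  have "bij_betw (\<lambda>x. x * c) {x. \<theta> x = x} {x. skew_op a [:- b, 1:] x = 0}"
  proof (rule bij_betw_byWitness[of _ "\<lambda>x. x / c"])
    have "\<theta> (x / c) = x / c" if x: "\<theta> x * a = b * x" for x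
    proof -
      have "\<theta> (x / c) * \<theta> c = \<theta> x"
        using assms(1) by (simp flip: endo_mult)
      then have "\<theta> (x / c) * (\<theta> c * a) = b * x"
        using x by (simp flip: mult.assoc)
      also have "\<dots> = x / c * (\<theta> c * a)" using assms by simp
      finally show ?thesis
        using a assms(1) mult_right_cancel[of "\<theta> c * a"] by (simp del: times_divide_eq_left)
    qed
    then show "(\<lambda>x. x / c) ` {x. skew_op a [:- b, 1:] x = 0} \<subseteq> {x. \<theta> x = x}"
      by (auto simp: skew_op_linear)
    show "(\<lambda>x. x * c) ` {x. \<theta> x = x} \<subseteq> {x. skew_op a [:- b, 1:] x = 0}"
      using assms by (auto simp: skew_op_linear endo_mult mult.assoc mult.left_commute)
  qed (use assms in auto)
  then show ?thesis
    using bij_betw_same_card card_fixed_field by fastforce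
qed

section \<open>Conjugacy classes, the weight, and the resulting degree bounds\<close>

definition M :: nat where
  "M = (p ^ n - 1) div (p - 1)"

text \<open>Every nonzero \<open>c\<close> conjugates exactly one \<open>a\<close> to \<open>b\<close>, and each such \<open>a\<close> occurs
  \<open>p - 1\<close> times.\<close>

lemma card_conjugates_mult:
  assumes "b \<noteq> 0"
  shows "card {a. \<exists>c. c \<noteq> 0 \<and> \<theta> c * a = b * c} * (p - 1) = p ^ n - 1"
proof -
  let ?A = "{a. \<exists>c. c \<noteq> 0 \<and> \<theta> c * a = b * c}"
  let ?K = "\<lambda>a. {x. skew_op a [:- b, 1:] x = 0} - {0}"
  have K: "c \<in> ?K a \<longleftrightarrow> c \<noteq> 0 \<and> \<theta> c * a = b * c" for a c
    by (simp add: skew_op_linear conj_commute)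
  have union: "(\<Union>a\<in>?A. ?K a) = UNIV - {0}"
  proof (intro equalityI subsetI)
    fix c :: 'a assume "c \<in> UNIV - {0}"
    then have "c \<noteq> 0" "\<theta> c * (b * c / \<theta> c) = b * c" by simp_all
    then have "b * c / \<theta> c \<in> ?A" "c \<in> ?K (b * c / \<theta> c)"
      unfolding K by blast+
    then show "c \<in> (\<Union>a\<in>?A. ?K a)" by (rule UN_I)
  qed simp
  have card_K: "card (?K a) = p - 1" if "a \<in> ?A" for a
  proof -
    from that obtain c where "c \<noteq> 0" "\<theta> c * a = b * c" by blast
    then have "card {x. skew_op a [:- b, 1:] x = 0} = p"
      using assms by (rule card_kernel_linear)
    then show ?thesis by (subst card_Diff_singleton) simp_all
  qed
  have "(\<Sum>a\<in>?A. card (?K a)) = (\<Sum>a\<in>?A. p - 1)"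
    by (rule sum.cong[OF refl card_K])
  then have "card ?A * (p - 1) = (\<Sum>a\<in>?A. card (?K a))"
    by (simp only: sum_constant of_nat_id)
  also have "\<dots> = card (\<Union>a\<in>?A. ?K a)"
  proof (rule card_UN_disjoint[symmetric])
    have "a = a'" if "c \<in> ?K a" "c \<in> ?K a'" for a a' c
    proof -
      have "c \<noteq> 0" "\<theta> c * a = \<theta> c * a'" using that unfolding K by simp_all
      then show ?thesis by simp
    qed
    then show "\<forall>a\<in>?A. \<forall>a'\<in>?A. a \<noteq> a' \<longrightarrow> ?K a \<inter> ?K a' = {}" by blast
  qed simp_all
  also have "\<dots> = p ^ n - 1"
    unfolding union by (simp add: card_Diff_singleton card_field)
  finally show ?thesis .
qed

lemma card_conjugates:
  assumes "b \<noteq> 0"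
  shows "card {a. \<exists>c. c \<noteq> 0 \<and> \<theta> c * a = b * c} = M"
  unfolding M_def card_conjugates_mult[OF assms, symmetric] using p_ge_2 by simp

lemma M_mult: "M * (p - 1) = p ^ n - 1"
  using card_conjugates_mult[of 1] card_conjugates[of 1] by simp

lemma M_pos: "M > 0"
proof -
  have "1 < p ^ n" using p_ge_2 n_pos by (intro one_less_power) auto
  then have "M * (p - 1) \<noteq> 0" unfolding M_mult by simp
  then show ?thesis by simp
qed

text \<open>By \<open>skew_op_eq_0_iff_root\<close>, the kernels in \<open>weight f\<close> are \<open>\<bbbF>\<^sub>p\<close>-spaces built from the roots
  of \<open>f\<close> in each conjugacy class; there are \<open>M\<close> elements in each nonzero class.  Thus
  \<open>weight f = p ^ (M * r)\<close>, where \<open>r\<close> is the rank of the set of roots of \<open>f\<close>.\<close>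

definition weight :: "'a poly \<Rightarrow> nat" where
  "weight f = (\<Prod>a\<in>UNIV - {0}. card {c. skew_op a f c = 0}) *
                (if coeff f 0 = 0 then p ^ M else 1)"

text \<open>The inequality holds factor by factor: for the kernels by
  \<open>card_kernel_comp_le\<close>, and for the last factor because the constant coefficients
  multiply.\<close>

lemma weight_mult_le: "weight (h \<star> g) \<le> weight h * weight g"
proof -
  let ?k = "\<lambda>f a. card {c. skew_op a f c = 0}"
  let ?z = "\<lambda>f. if coeff f 0 = 0 then p ^ M else 1"
  have "(\<Prod>a\<in>UNIV - {0}. ?k (h \<star> g) a) \<le> (\<Prod>a\<in>UNIV - {0}. ?k h a * ?k g a)"
    unfolding skew_op_mult by (intro prod_mono conjI card_kernel_comp_le) (simp_all add: skew_op_diff)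
  moreover have "?z (h \<star> g) \<le> ?z h * ?z g"
    using p_ge_2 by auto
  ultimately have "weight (h \<star> g) \<le> (\<Prod>a\<in>UNIV - {0}. ?k h a * ?k g a) * (?z h * ?z g)"
    unfolding weight_def by (intro mult_le_mono)
  also have "\<dots> = weight h * weight g"
    by (simp only: weight_def prod.distrib mult_ac)
  finally show ?thesis .
qed

text \<open>If \<open>b\<close> is nonzero, exactly its \<open>M\<close> conjugates contribute a
  factor \<open>p\<close>. If \<open>b = 0\<close>, all kernels are trivial and the last factor of
  \<open>weight\<close> makes up for them.\<close>

lemma weight_linear: "weight [:- b, 1:] = p ^ M"
proof (cases "b = 0")
  case True
  then show ?thesis by (simp add: weight_def skew_op_linear[of _ 0, simplified])
next
  case False
  let ?A = "{a. \<exists>c. c \<noteq> 0 \<and> \<theta> c * a = b * c}"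
  have "(\<Prod>a\<in>UNIV - {0}. card {c. skew_op a [:- b, 1:] c = 0}) = (\<Prod>a\<in>?A. p)"
  proof (rule prod.mono_neutral_cong_right)
    show "?A \<subseteq> UNIV - {0}" using False by auto
    show "\<forall>a\<in>UNIV - {0} - ?A. card {c. skew_op a [:- b, 1:] c = 0} = 1"
    proof
      fix a assume "a \<in> UNIV - {0} - ?A"
      then have "{c. skew_op a [:- b, 1:] c = 0} = {0}"
        by (auto simp: skew_op_linear endo_zero)
      then show "card {c. skew_op a [:- b, 1:] c = 0} = 1" by simp
    qed
  qed (use False in \<open>auto intro: card_kernel_linear\<close>)
  then show ?thesis
    using False by (simp add: weight_def card_conjugates)
qed

text \<open>The nonzero elements of the kernel at \<open>a\<close> are read off from the roots
  conjugate to \<open>a\<close>, and the constant coefficient tells whether \<open>0\<close> is a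
  root.\<close>

lemma weight_cong:
  assumes "\<And>a. skew_op a f 1 = 0 \<longleftrightarrow> skew_op a g 1 = 0"
  shows "weight f = weight g"
proof -
  have "skew_op a f c = 0 \<longleftrightarrow> skew_op a g c = 0" for a c
    using assms by (cases "c = 0") (simp_all add: skew_op_eq_0_iff_root[of c])
  moreover have "coeff f 0 = 0 \<longleftrightarrow> coeff g 0 = 0"
    using assms[of 0] by (simp add: skew_op_0_left)
  ultimately show ?thesis by (simp add: weight_def)
qed

lemma weight_le:
  assumes "f \<noteq> 0"
  shows "weight f \<le> p ^ (M * degree f)"
  using assms
proof (induction "degree f" arbitrary: f rule: less_induct)
  case less
  show ?case
  proof (cases "\<exists>b. skew_op b f 1 = 0")
    case True
    then obtain b h where f: "f = h \<star> [:- b, 1:]"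
      by (auto simp: left_multiples_iff simp flip: left_multiples_linear_iff)
    with less.prems have "h \<noteq> 0" by auto
    then have deg: "degree f = degree h + 1" by (simp add: f degree_skew_mult)
    have "weight f \<le> weight h * p ^ M"
      using weight_mult_le[of h "[:- b, 1:]"] by (simp add: f weight_linear)
    also have "\<dots> \<le> p ^ (M * degree h) * p ^ M"
      using less.hyps[of h] \<open>h \<noteq> 0\<close> deg by (intro mult_le_mono1) auto
    also have "\<dots> = p ^ (M * degree f)" by (simp add: deg power_add)
    finally show ?thesis .
  next
    case False
    \<comment> \<open>Like \<open>f\<close>, the constant \<open>1\<close> has no root.\<close>
    then have "weight f = weight 1"
      by (intro weight_cong) (simp add: skew_op_def)
    moreover have "weight 1 = 1" by (simp add: weight_def skew_op_def)
    ultimately show ?thesis using p_ge_2 by simp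
  qed
qed

text \<open>Each kernel is the whole field, since all conjugates of a nonzero \<open>a\<close> are
  nonzero; the exponent comes from \<open>p ^ n - 1 = M * (p - 1)\<close>.\<close>

lemma prod_card_kernel_if_vanishing:
  assumes "\<And>a. a \<noteq> 0 \<Longrightarrow> skew_op a f 1 = 0"
  shows "(\<Prod>a\<in>UNIV - {0}. card {c. skew_op a f c = 0}) = p ^ (M * ((p - 1) * n))"
proof -
  have "skew_op a f c = 0" if "a \<noteq> 0" for a c
    using assms that by (cases "c = 0") (simp_all add: skew_op_eq_0_iff_root[of c])
  then have "(\<Prod>a\<in>UNIV - {0}. card {c. skew_op a f c = 0}) = (\<Prod>a\<in>UNIV - {0 :: 'a}. p ^ n)"
    by (intro prod.cong) (auto simp: card_field)
  also have "\<dots> = p ^ (n * (p ^ n - 1))"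
    by (simp add: card_Diff_singleton card_field power_mult)
  also have "n * (p ^ n - 1) = M * ((p - 1) * n)"
    unfolding M_mult[symmetric] by (simp only: mult_ac)
  finally show ?thesis .
qed

lemma power_M_le_iff: "p ^ (M * i) \<le> p ^ (M * j) \<longleftrightarrow> i \<le> j"
  using p_ge_2 M_pos by (simp add: power_increasing_iff)

lemma degree_ge_if_vanishing_nonzero:
  assumes "f \<noteq> 0" "\<And>a. a \<noteq> 0 \<Longrightarrow> skew_op a f 1 = 0"
  shows "(p - 1) * n \<le> degree f"
proof -
  have "p ^ (M * ((p - 1) * n)) \<le> weight f"
    using p_ge_2 by (simp add: weight_def prod_card_kernel_if_vanishing[OF assms(2)])
  also note weight_le[OF assms(1)]
  finally show ?thesis by (simp only: power_M_le_iff)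
qed

lemma weight_if_vanishing:
  assumes "\<And>a. skew_op a f 1 = 0"
  shows "weight f = p ^ (M * ((p - 1) * n + 1))"
  using assms[of 0] prod_card_kernel_if_vanishing[OF assms]
  by (simp add: weight_def skew_op_0_left power_add)

lemma degree_ge_if_vanishing:
  assumes "f \<noteq> 0" "\<And>a. skew_op a f 1 = 0"
  shows "(p - 1) * n + 1 \<le> degree f"
  using weight_le[OF assms(1)] unfolding weight_if_vanishing[OF assms(2)] power_M_le_iff .

section \<open>The polynomials \<open>G\<close> and \<open>G0\<close> as least left common
  multiples\<close>

definition G0 :: "'a poly" where
  "G0 = monom 1 ((p - 1) * n) - 1"

definition G :: "'a poly" where
  "G = monom 1 ((p - 1) * n + 1) - monom 1 1"

lemma pn_pos: "(p - 1) * n > 0"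
  using p_ge_2 n_pos by simp

text \<open>The norm \<open>T a ^^ n\<close> of \<open>1\<close> is fixed by \<open>\<theta>\<close>, so its \<open>(p - 1)\<close>-st power is \<open>1\<close>.\<close>

lemma T_funpow_one:
  assumes "a \<noteq> 0"
  shows "(T a ^^ ((p - 1) * n)) 1 = 1"
proof -
  define c where "c = (T a ^^ n) 1"
  \<comment> \<open>As \<open>\<theta> ^^ n\<close> is the identity, \<open>T a ^^ n\<close> is
    multiplication by the norm \<open>c\<close> of \<open>a\<close>.\<close>
  have T_n: "(T a ^^ n) x = x * c" for x
    using T_funpow_mult[where b = x and c = 1] by (simp add: c_def endo_funpow_n)
  have c: "c \<noteq> 0"
  proof -
    have "(T a ^^ i) 1 \<noteq> 0" for i
      using assms by (induction i) auto
    then show ?thesis by (simp add: c_def)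
  qed
  \<comment> \<open>Applying the additional \<open>T a\<close> after or before
    \<open>T a ^^ n\<close> computes the same element in two ways.\<close>
  have "\<theta> c * a = (T a ^^ Suc n) 1" by (simp add: c_def)
  also have "\<dots> = (T a ^^ n) (T a 1)" by (simp only: funpow_Suc_right o_apply)
  also have "\<dots> = a * c" by (simp add: T_n endo_one)
  finally have "\<theta> c = c" using assms by simp
  then have "c ^ (p - 1) * c = 1 * c"
    using p_ge_2 by (simp add: frobenius flip: power_Suc2)
  then have "c ^ (p - 1) = 1" using c by simp
  moreover have "(T a ^^ (k * n)) 1 = c ^ k" for k
    by (induction k) (simp_all add: Nat.funpow_add T_n)
  ultimately show ?thesis by simp
qed

lemma G0_vanishing: "a \<noteq> 0 \<Longrightarrow> skew_op a G0 1 = 0"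
  using skew_op_monom[of a 1 0 1] T_funpow_one[of a]
  by (simp add: G0_def skew_op_poly_diff skew_op_monom)

lemma G_vanishing: "skew_op a G 1 = 0"
proof (cases "a = 0")
  case False
  have "(T a ^^ ((p - 1) * n + 1)) 1 = (T a ^^ 1) 1"
    using T_funpow_one[OF False] by simp
  then show ?thesis
    by (simp add: G_def skew_op_poly_diff skew_op_monom)
qed (simp add: G_def skew_op_0_left)

lemma degree_monic_monom_diff:
  assumes "degree f < k"
  shows "degree (monom 1 k - f) = k" "monic (monom 1 k - f)"
proof -
  have "degree (- f) < degree (monom (1 :: 'a) k)"
    using assms by (simp add: degree_monom_eq)
  then show "degree (monom 1 k - f) = k"
    using degree_add_eq_left[of "- f" "monom 1 k"] by (simp add: degree_monom_eq)
  then show "monic (monom 1 k - f)"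
    using assms by (simp add: coeff_eq_0)
qed

lemma degree_G0: "degree G0 = (p - 1) * n" and monic_G0: "monic G0"
  unfolding G0_def by (rule degree_monic_monom_diff; use pn_pos in simp)+

lemma degree_G: "degree G = (p - 1) * n + 1" and monic_G: "monic G"
  unfolding G_def by (rule degree_monic_monom_diff; use pn_pos in \<open>simp add: degree_monom_eq\<close>)+

lemma G_nonzero: "G \<noteq> 0" and G0_nonzero: "G0 \<noteq> 0"
  using monic_G monic_G0 by auto

lemma llcm_G: "is_llcm_linear (skew_poly_ring \<theta>) UNIV G"
  by (rule is_llcm_linearI[OF monic_G])
     (use degree_ge_if_vanishing in \<open>auto simp: degree_G G_vanishing\<close>)

lemma llcm_G0: "is_llcm_linear (skew_poly_ring \<theta>) (UNIV - {0}) G0"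
  by (rule is_llcm_linearI[OF monic_G0])
     (use degree_ge_if_vanishing_nonzero in \<open>auto simp: degree_G0 G0_vanishing\<close>)

section \<open>Commutation rules and the exchange of cofactors\<close>

lemma map_poly_endo_add: "map_poly \<theta> (f + g) = map_poly \<theta> f + map_poly \<theta> g"
  by (rule poly_eqI) (simp add: coeff_map_poly endo_zero endo_add)

text \<open>The exponent \<open>(p - 1) * n\<close> is a multiple of the period \<open>n\<close> of
  \<open>\<theta>\<close>, so this power of \<open>t\<close> commutes with all coefficients.\<close>

lemma G0_central: "G0 \<star> h = h \<star> G0"
proof -
  have "monom 1 ((p - 1) * n) \<star> h = h \<star> monom 1 ((p - 1) * n)"
  proof (induction h rule: poly_add_induct)
    case (1 a i)
    show ?case
      by (simp add: skew_mult_monom endo_funpow_mult_n funpow_one add.commute)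
  qed (simp add: skew_mult_add_left skew_mult_add_right)
  then show ?thesis
    by (simp add: G0_def skew_mult_diff_left skew_mult_diff_right
        skew_mult_one_left skew_mult_one_right)
qed

text \<open>Both exponents in \<open>G\<close> are congruent to \<open>1\<close> modulo
  \<open>n\<close>, so each of its two terms applies \<open>\<theta>\<close> once to a coefficient
  it passes.\<close>

lemma G_commute: "G \<star> h = map_poly \<theta> h \<star> G"
proof (induction h rule: poly_add_induct)
  case (1 a i)
  show ?case
    by (simp add: G_def skew_mult_diff_left skew_mult_diff_right skew_mult_monom
        map_poly_monom endo_zero endo_funpow_mult_n funpow_one endo_one add.commute)
qed (simp add: skew_mult_add_left skew_mult_add_right map_poly_endo_add)

text \<open>With \<open>g' = map_poly \<theta> g\<close> one has
  \<open>g' \<star> h \<star> g = g' \<star> G = G \<star> g\<close>, and \<open>g\<close> cancels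
  on the right.\<close>

lemma G_factors_swap:
  assumes "h \<star> g = G"
  shows "map_poly \<theta> g \<star> h = G"
proof -
  have "g \<noteq> 0" using assms G_nonzero by auto
  moreover have "map_poly \<theta> g \<star> h \<star> g = G \<star> g"
    by (simp add: skew_mult_assoc assms G_commute)
  ultimately show ?thesis by (simp add: skew_mult_right_cancel)
qed

lemma G0_factors_swap:
  assumes "h \<star> g = G0"
  shows "g \<star> h = G0"
proof -
  have "g \<noteq> 0" using assms G0_nonzero by auto
  moreover have "g \<star> h \<star> g = G0 \<star> g"
    by (simp add: skew_mult_assoc assms G0_central)
  ultimately show ?thesis by (simp add: skew_mult_right_cancel)
qed

section \<open>Left and right factors of \<open>G\<close>, and the W-polynomials\<close>

lemma left_factor_G_iff:
  "left_factor (skew_poly_ring \<theta>) g G \<longleftrightarrow> right_factor (skew_poly_ring \<theta>) g G"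
proof
  assume "left_factor (skew_poly_ring \<theta>) g G"
  then show "right_factor (skew_poly_ring \<theta>) g G"
    unfolding left_factor_def right_factor_def left_multiples_iff right_multiples_iff
    using G_factors_swap by metis
next
  assume "right_factor (skew_poly_ring \<theta>) g G"
  then obtain h where h: "h \<star> g = G"
    unfolding right_factor_def left_multiples_iff by metis
  \<comment> \<open>The idea is to apply \<open>map_poly \<theta> ^^ (n - 1)\<close> to
    \<open>map_poly \<theta> g \<star> h = G\<close>: the first factor becomes \<open>g\<close>
    because \<open>\<theta> ^^ n\<close> is the identity, and \<open>G\<close> is fixed because its
    coefficients are \<open>0\<close>, \<open>1\<close> and \<open>-1\<close>.\<close>
  have map_k: "map_poly \<theta> ((map_poly \<theta> ^^ k) f) = (map_poly \<theta> ^^ k) (map_poly \<theta> f)" for k f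
    by (simp add: funpow_swap1)
  have mult_k: "(map_poly \<theta> ^^ k) (f \<star> f') = (map_poly \<theta> ^^ k) f \<star> (map_poly \<theta> ^^ k) f'"
    for k f f' by (induction k) (simp_all add: map_poly_skew_mult)
  have "coeff ((map_poly \<theta> ^^ k) f) i = (\<theta> ^^ k) (coeff f i)" for k f i
    by (induction k) (simp_all add: coeff_map_poly endo_zero)
  then have period: "(map_poly \<theta> ^^ n) f = f" for f
    by (intro poly_eqI) (simp add: endo_funpow_n)
  have "(map_poly \<theta> ^^ (n - 1)) (map_poly \<theta> g) = (map_poly \<theta> ^^ Suc (n - 1)) g"
    by (simp only: funpow_Suc_right o_apply)
  also have "\<dots> = g" using n_pos period by simp
  finally have g: "(map_poly \<theta> ^^ (n - 1)) (map_poly \<theta> g) = g" .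
  have "map_poly \<theta> G = G"
    by (rule poly_eqI) (simp add: coeff_map_poly endo_zero G_def endo_diff endo_one)
  then have "(map_poly \<theta> ^^ k) G = G" for k by (induction k) auto
  then have "G = g \<star> (map_poly \<theta> ^^ (n - 1)) h"
    using G_factors_swap[OF h] mult_k[of "n - 1" "map_poly \<theta> g" h] g by simp
  then show "left_factor (skew_poly_ring \<theta>) g G"
    unfolding left_factor_def right_multiples_iff by blast
qed

text \<open>Both factors of \<open>G = h g\<close> attain the bound \<open>weight_le\<close>, since \<open>G\<close> does.  The least left
  common multiple of the \<open>t - a\<close> over the roots \<open>a\<close> of \<open>g\<close> divides \<open>g\<close> and has the weight
  of \<open>g\<close>, hence it also has the degree of \<open>g\<close>.\<close>

lemma W_polynomial_if_right_factor_G: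
  assumes "monic g" "right_factor (skew_poly_ring \<theta>) g G"
  shows "W_polynomial (skew_poly_ring \<theta>) g"
proof -
  obtain h where h: "G = h \<star> g"
    using assms(2) by (auto simp: right_factor_def left_multiples_iff)
  have nz: "h \<noteq> 0" "g \<noteq> 0" using h G_nonzero by auto
  have "p ^ (M * degree h) * p ^ (M * degree g) = p ^ (M * degree G)"
    by (simp add: h degree_skew_mult nz distrib_left power_add)
  also have "\<dots> = weight G"
    by (simp only: weight_if_vanishing[OF G_vanishing] degree_G)
  also have "\<dots> \<le> weight h * weight g" unfolding h by (rule weight_mult_le)
  also have "\<dots> \<le> p ^ (M * degree h) * weight g"
    by (intro mult_le_mono1 weight_le nz)
  finally have g_max: "p ^ (M * degree g) \<le> weight g"
    using p_ge_2 by simp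
  define S where "S = {a. skew_op a g 1 = 0}"
  obtain m where m: "is_llcm_linear (skew_poly_ring \<theta>) S m"
    using ex_llcm_linear_basis[of S] by auto
  have "m \<noteq> 0" using m by (auto simp: is_llcm_linear_iff)
  have "g \<in> multiples m" using m by (auto simp: is_llcm_linear_iff S_def)
  then obtain k where k: "g = k \<star> m" by (auto simp: left_multiples_iff)
  have m_S: "\<forall>a\<in>S. skew_op a m 1 = 0"
    using m left_multiples_self by (auto simp: is_llcm_linear_iff)
  \<comment> \<open>Roots of \<open>g\<close> lie in \<open>S\<close>, where \<open>m\<close>
    vanishes; roots of \<open>m\<close> are roots of its left multiple \<open>g\<close>.\<close>
  then have "skew_op a g 1 = 0 \<longleftrightarrow> skew_op a m 1 = 0" for a
    by (auto simp: S_def) (simp add: k skew_op_mult)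
  then have "weight g = weight m" by (rule weight_cong)
  also have "\<dots> \<le> p ^ (M * degree m)" using \<open>m \<noteq> 0\<close> by (rule weight_le)
  finally have deg: "degree g \<le> degree m"
    using g_max power_M_le_iff order_trans by blast
  have "is_llcm_linear (skew_poly_ring \<theta>) S g"
  proof (rule is_llcm_linearI)
    fix f assume f: "f \<noteq> 0" "\<forall>a\<in>S. skew_op a f 1 = 0"
    then have "f \<in> multiples m" using m by (simp add: is_llcm_linear_iff)
    then obtain l where "f = l \<star> m" by (auto simp: left_multiples_iff)
    then have "degree f = degree l + degree m" using f(1) by (auto simp: degree_skew_mult)
    then show "degree g \<le> degree f" using deg by simp
  qed (use assms(1) in \<open>auto simp: S_def\<close>)
  then show ?thesis by (intro W_polynomial_if_llcm[of S]) auto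
qed

lemma W_polynomial_iff:
  "W_polynomial (skew_poly_ring \<theta>) g \<longleftrightarrow> monic g \<and> right_factor (skew_poly_ring \<theta>) g G"
proof
  assume "W_polynomial (skew_poly_ring \<theta>) g"
  then obtain a where "monic g"
      and g: "multiples g = (\<Inter>i\<in>{1..degree g}. multiples [:- a i, 1:])"
    unfolding W_polynomial_def by blast
  moreover have "G \<in> multiples g"
    unfolding g by (simp add: left_multiples_linear_iff G_vanishing)
  ultimately show "monic g \<and> right_factor (skew_poly_ring \<theta>) g G"
    by (simp add: right_factor_def)
qed (use W_polynomial_if_right_factor_G in blast)

lemma G_properties:
  defines "R \<equiv> skew_poly_ring \<theta>"
  shows
    "(is_llcm_linear R UNIV G \<and> is_llcm_linear R (UNIV - {0}) G0) \<and>
     ((\<forall>h \<in> carrier R. G \<otimes>\<^bsub>R\<^esub> h = map_poly \<theta> h \<otimes>\<^bsub>R\<^esub> G) \<and> G0 \<in> ring_center R) \<and>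
     ((\<forall>g \<in> carrier R. \<forall>h \<in> carrier R. monic g \<and> monic h \<and> h \<otimes>\<^bsub>R\<^esub> g = G \<longrightarrow>
          map_poly \<theta> g \<otimes>\<^bsub>R\<^esub> h = G) \<and>
      (\<forall>g \<in> carrier R. \<forall>h \<in> carrier R. monic g \<and> monic h \<and> h \<otimes>\<^bsub>R\<^esub> g = G0 \<longrightarrow>
          g \<otimes>\<^bsub>R\<^esub> h = G0)) \<and>
     ({g \<in> carrier R. W_polynomial R g} = {g \<in> carrier R. monic g \<and> right_factor R g G} \<and>
      {g \<in> carrier R. W_polynomial R g} = {g \<in> carrier R. monic g \<and> left_factor R g G})"
proof -
  have W: "{g \<in> carrier R. W_polynomial R g} = {g \<in> carrier R. monic g \<and> right_factor R g G}"
    by (simp add: R_def W_polynomial_iff)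
  moreover have "{g \<in> carrier R. W_polynomial R g} = {g \<in> carrier R. monic g \<and> left_factor R g G}"
    unfolding W by (simp add: R_def left_factor_G_iff)
  moreover have "is_llcm_linear R UNIV G" "is_llcm_linear R (UNIV - {0}) G0"
    using llcm_G llcm_G0 by (simp_all only: R_def)
  moreover have "\<forall>h \<in> carrier R. G \<otimes>\<^bsub>R\<^esub> h = map_poly \<theta> h \<otimes>\<^bsub>R\<^esub> G" "G0 \<in> ring_center R"
    unfolding R_def ring_center_def
    by (simp_all add: G_commute) (intro allI G0_central)
  moreover have "\<forall>g \<in> carrier R. \<forall>h \<in> carrier R.
      monic g \<and> monic h \<and> h \<otimes>\<^bsub>R\<^esub> g = G \<longrightarrow> map_poly \<theta> g \<otimes>\<^bsub>R\<^esub> h = G"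
    unfolding R_def mult_skew_poly_ring using G_factors_swap by blast
  moreover have "\<forall>g \<in> carrier R. \<forall>h \<in> carrier R.
      monic g \<and> monic h \<and> h \<otimes>\<^bsub>R\<^esub> g = G0 \<longrightarrow> g \<otimes>\<^bsub>R\<^esub> h = G0"
    unfolding R_def mult_skew_poly_ring using G0_factors_swap by blast
  ultimately show ?thesis by blast
qed

end

theorem theorem4p5:
  fixes p n :: nat
    and \<theta> :: "'a::finite_field \<Rightarrow> 'a"
    and R :: "'a poly ring"
    and G G\<^sub>0 :: "'a poly"
  assumes "prime p" and "n \<ge> 1" and "card (UNIV :: 'a set) = p ^ n"
    and "\<theta> = (\<lambda>a. a ^ p)"
    and "R = skew_poly_ring \<theta>"
    and "G = monom 1 ((p - 1) * n + 1) - monom 1 1"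
    and "G\<^sub>0 = monom 1 ((p - 1) * n) - 1"
  shows
    "(is_llcm_linear R UNIV G \<and> is_llcm_linear R (UNIV - {0}) G\<^sub>0) \<and>
     ((\<forall>h \<in> carrier R. G \<otimes>\<^bsub>R\<^esub> h = map_poly \<theta> h \<otimes>\<^bsub>R\<^esub> G) \<and> G\<^sub>0 \<in> ring_center R) \<and>
     ((\<forall>g \<in> carrier R. \<forall>h \<in> carrier R. monic g \<and> monic h \<and> h \<otimes>\<^bsub>R\<^esub> g = G \<longrightarrow>
          map_poly \<theta> g \<otimes>\<^bsub>R\<^esub> h = G) \<and>
      (\<forall>g \<in> carrier R. \<forall>h \<in> carrier R. monic g \<and> monic h \<and> h \<otimes>\<^bsub>R\<^esub> g = G\<^sub>0 \<longrightarrow>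
          g \<otimes>\<^bsub>R\<^esub> h = G\<^sub>0)) \<and>
     ({g \<in> carrier R. W_polynomial R g} = {g \<in> carrier R. monic g \<and> right_factor R g G} \<and>
      {g \<in> carrier R. W_polynomial R g} = {g \<in> carrier R. monic g \<and> left_factor R g G})"
proof -
  have F: "finite_frobenius \<theta> p n"
    using assms by unfold_locales
  show ?thesis
    unfolding \<open>R = skew_poly_ring \<theta>\<close> \<open>G = _\<close> \<open>G\<^sub>0 = _\<close>
    by (rule finite_frobenius.G_properties[OF F,
          unfolded finite_frobenius.G_def[OF F] finite_frobenius.G0_def[OF F]])
qed

end
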